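(* For every $n\ge1$ and every $d\ge2$: (a) there is a system $F$ of $n+1$ tropical polynomials in $n$ variables over the semiring $\mathbb{R}$, of degree at most $d$, such that $F$ has no root in $\mathbb{R}^n$ but the Macaulay tropical linear system $M_N\odot\vec y$ of $F$ with $N=(d-1)(n-1)$ has a solution over $\mathbb{R}$; (b) there is a system $F$ of $n+1$ min-plus polynomials in $n$ variables over the semiring $\mathbb{R}$, of degree at most $d$, such that $F$ has no root in $\mathbb{R}^n$ but the Macaulay min-plus linear system $\mathit{Ml}_N\odot\vec y=\mathit{Mr}_N\odot\vec y$ of $F$ with $N=(d-1)(n-1)$ has a solution over $\mathbb{R}$.
   Context: Tropical operations on $\mathbb{R}$: $x\oplus y=\min\{x,y\}$, $x\odot y=x+y$. A tropical monomial is $m(\vec x)=c\odot \vec x^{I}$ with $c\in\mathbb{R}$, $I=(i_1,\dots,i_n)\in\mathbb{Z}_{\ge0}^n$ and $\vec x^{I}=i_1x_1+\dots+i_nx_n$ in classical notation; its degree is $|I|=i_1+\dots+i_n$. A tropical polynomial is a finite tropical sum $f=\min_i m_i$ of monomials with pairwise distinct exponent vectors; its degree is the maximal degree of its monomials. A point $\vec a\in\mathbb{R}^n$ is a root of $f$ if $\min_i m_i(\vec a)$ is attained on at least two different monomials. A min-plus polynomial is a pair $(f,g)$ of tropical polynomials, of degree $\max(\deg f,\deg g)$; $\vec a$ is a root of it if $f(\vec a)=g(\vec a)$. A root of a system is a common root of all its members. Macaulay matrices: for a tropical system $\{f_1,\dots,f_k\}$ the infinite matrix $M$ has columns indexed by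 $I\in\mathbb{Z}_{\ge0}^n$ and rows indexed by pairs $(j,J)$, $1\le j\le k$, $J\in\mathbb{Z}_{\ge0}^n$; the entry in row $(j,J)$ and column $I$ is the coefficient of $\vec x^I$ in $\vec x^J\odot f_j$ ($\infty$ if absent). $M_N$ is the submatrix consisting of the columns $I$ with $|I|\le N$ and of those rows all of whose finite entries lie in these columns. For a min-plus system $\{(f_j,g_j)\}$ the matrices $\mathit{Ml}$, $\mathit{Mr}$ are defined in the same way from the $f_j$ and from the $g_j$ respectively, and $\mathit{Ml}_N,\mathit{Mr}_N$ consist of the columns $|I|\le N$ and of the rows $(j,J)$ whose finite entries in both $\mathit{Ml}$ and $\mathit{Mr}$ lie in these columns. A real vector $\vec y$ is a solution of $M_N\odot\vec y$ if for each row $r$ the minimum $\min_I(m_{r,I}+y_I)$ is attained for at least two different $I$ (or equals $\infty$); a real vector $\vec y$ is a solution of $\mathit{Ml}_N\odot\vec y=\mathit{Mr}_N\odot\vec y$ if in each row $r$ the minima $\min_I(\mathit{Ml}_{r,I}+y_I)$ and $\min_I(\mathit{Mr}_{r,I}+y_I)$ are equal. *)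

theory Defs
  imports "HOL-Library.Extended_Real"
begin

text \<open>
  Points of $R^n$ and exponent vectors are functions on \<^typ>\<open>nat\<close> whose coordinates are the
  indices below \<^term>\<open>n\<close>. For exponent vectors the remaining coordinates are required to vanish,
  so that different functions are different vectors. For points they are irrelevant, because
  only the coordinates below \<^term>\<open>n\<close> are ever used.
\<close>

type_synonym exponent = "nat \<Rightarrow> nat"

definition exponents :: "nat \<Rightarrow> exponent set" where
  "exponents n = {I. \<forall>i\<ge>n. I i = 0}"

definition exp_degree :: "nat \<Rightarrow> exponent \<Rightarrow> nat" where
  "exp_degree n I = (\<Sum>i<n. I i)"

text \<open>
  A tropical polynomial is given by its coefficient function; the coefficient
  \<^term>\<open>\<infinity> :: ereal\<close> marks an absent monomial. All other coefficients are real, and there is at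
  least one monomial: the semiring is $R$ without $\infty$, so the empty sum is excluded.
\<close>

type_synonym trop_poly = "exponent \<Rightarrow> ereal"

definition monomials :: "trop_poly \<Rightarrow> exponent set" where
  "monomials f = {I. f I \<noteq> \<infinity>}"

definition is_trop_poly :: "nat \<Rightarrow> trop_poly \<Rightarrow> bool" where
  "is_trop_poly n f \<longleftrightarrow>
     finite (monomials f) \<and> monomials f \<noteq> {} \<and> monomials f \<subseteq> exponents n \<and>
     (\<forall>I. f I \<noteq> -\<infinity>)"

definition trop_degree :: "nat \<Rightarrow> trop_poly \<Rightarrow> nat" where
  "trop_degree n f = Max (exp_degree n ` monomials f)"

definition monomial_value :: "nat \<Rightarrow> trop_poly \<Rightarrow> exponent \<Rightarrow> (nat \<Rightarrow> real) \<Rightarrow> ereal" where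
  "monomial_value n f I a = f I + ereal (\<Sum>i<n. real (I i) * a i)"

definition trop_value :: "nat \<Rightarrow> trop_poly \<Rightarrow> (nat \<Rightarrow> real) \<Rightarrow> ereal" where
  "trop_value n f a = (MIN I\<in>monomials f. monomial_value n f I a)"

definition trop_root :: "nat \<Rightarrow> trop_poly \<Rightarrow> (nat \<Rightarrow> real) \<Rightarrow> bool" where
  "trop_root n f a \<longleftrightarrow>
     (\<exists>I\<in>monomials f. \<exists>I'\<in>monomials f. I \<noteq> I' \<and>
        monomial_value n f I a = trop_value n f a \<and>
        monomial_value n f I' a = trop_value n f a)"

type_synonym minplus_poly = "trop_poly \<times> trop_poly"

definition is_minplus_poly :: "nat \<Rightarrow> minplus_poly \<Rightarrow> bool" where
  "is_minplus_poly n p \<longleftrightarrow> is_trop_poly n (fst p) \<and> is_trop_poly n (snd p)"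

definition minplus_degree :: "nat \<Rightarrow> minplus_poly \<Rightarrow> nat" where
  "minplus_degree n p = max (trop_degree n (fst p)) (trop_degree n (snd p))"

definition minplus_root :: "nat \<Rightarrow> minplus_poly \<Rightarrow> (nat \<Rightarrow> real) \<Rightarrow> bool" where
  "minplus_root n p a \<longleftrightarrow> trop_value n (fst p) a = trop_value n (snd p) a"

definition shift_poly :: "exponent \<Rightarrow> trop_poly \<Rightarrow> trop_poly" where
  "shift_poly J f = (\<lambda>I. if \<forall>i. J i \<le> I i then f (\<lambda>i. I i - J i) else \<infinity>)"

type_synonym row = "nat \<times> exponent"

text \<open>A system is a list of polynomials, so the index of a row counts from \<^term>\<open>0 :: nat\<close>.\<close>

definition macaulay :: "trop_poly list \<Rightarrow> row \<Rightarrow> exponent \<Rightarrow> ereal" where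
  "macaulay F r I = shift_poly (snd r) (F ! fst r) I"

definition macaulay_cols :: "nat \<Rightarrow> nat \<Rightarrow> exponent set" where
  "macaulay_cols n N = {I \<in> exponents n. exp_degree n I \<le> N}"

definition macaulay_rows :: "nat \<Rightarrow> trop_poly list \<Rightarrow> nat \<Rightarrow> row set" where
  "macaulay_rows n F N =
     {r. fst r < length F \<and> snd r \<in> exponents n \<and>
         (\<forall>I. macaulay F r I \<noteq> \<infinity> \<longrightarrow> I \<in> macaulay_cols n N)}"

definition trop_linear_solution ::
    "row set \<Rightarrow> exponent set \<Rightarrow> (row \<Rightarrow> exponent \<Rightarrow> ereal) \<Rightarrow> (exponent \<Rightarrow> real) \<Rightarrow> bool" where
  "trop_linear_solution R C M y \<longleftrightarrow>
     (\<forall>r\<in>R. let \<mu> = (MIN I\<in>C. M r I + ereal (y I)) in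
        \<mu> = \<infinity> \<or>
        (\<exists>I\<in>C. \<exists>I'\<in>C. I \<noteq> I' \<and> M r I + ereal (y I) = \<mu> \<and> M r I' + ereal (y I') = \<mu>))"

definition minplus_linear_solution ::
    "row set \<Rightarrow> exponent set \<Rightarrow> (row \<Rightarrow> exponent \<Rightarrow> ereal) \<Rightarrow> (row \<Rightarrow> exponent \<Rightarrow> ereal) \<Rightarrow>
     (exponent \<Rightarrow> real) \<Rightarrow> bool" where
  "minplus_linear_solution R C Ml Mr y \<longleftrightarrow>
     (\<forall>r\<in>R. (MIN I\<in>C. Ml r I + ereal (y I)) = (MIN I\<in>C. Mr r I + ereal (y I)))"

definition macaulay_trop_solution ::
    "nat \<Rightarrow> trop_poly list \<Rightarrow> nat \<Rightarrow> (exponent \<Rightarrow> real) \<Rightarrow> bool" where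
  "macaulay_trop_solution n F N y \<longleftrightarrow>
     trop_linear_solution (macaulay_rows n F N) (macaulay_cols n N) (macaulay F) y"

definition macaulay_minplus_solution ::
    "nat \<Rightarrow> minplus_poly list \<Rightarrow> nat \<Rightarrow> (exponent \<Rightarrow> real) \<Rightarrow> bool" where
  "macaulay_minplus_solution n F N y \<longleftrightarrow>
     minplus_linear_solution
       (macaulay_rows n (map fst F) N \<inter> macaulay_rows n (map snd F) N) (macaulay_cols n N)
       (macaulay (map fst F)) (macaulay (map snd F)) y"

end

theory Submission imports Defs begin

text \<open>
  Number the variables $x_1,\dots,x_n$ and read $x_0$ and $x_{n+1}$ as the constant monomial. Both
  systems consist of the $n+1$ relations
  $x_i^d = c_i \odot x_i^{d-1} x_{i+1}$ for $0 \le i \le n$, with $c_n = 1$ and all other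
  $c_i = 0$. The two sides are the terms of a binomial in the tropical system and the members of a
  pair in the min-plus system.
  At a root the relations say $a_i = c_i + a_{i+1}$ in a closed chain from $x_0$ to $x_{n+1}$, so
  that $\sum_i c_i = 1$ would have to be $0$ (\<open>no_common_root\<close>).

  A vector $y$ solves the Macaulay system once it satisfies
  $y(J x_i^d) = c_i + y(J x_i^{d-1} x_{i+1})$ in every row, because then the two finite entries of a
  row have the same value. Regard a monomial as a configuration of tokens on the sites
  $1,\dots,n$. A relation moves one token between the neighbouring sites $i$ and $i+1$ (site $0$,
  which is also site $n+1$, being an unlimited reservoir), but for $i \ge 1$ only while $d-1$ other
  tokens stay on site $i$. A contradiction needs a token that goes all the way round, on top of
  $d-1$ tokens kept busy on each of the $n$ sites, and is therefore impossible when there are at most $n(d-1)$ tokens. The quantitative form of this is the potential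
  \[ y(I) = \max_{1 \le k \le n+1} \sum_{j=k}^{n} (I_j - (d-1)), \]
  the largest surplus of tokens on a final segment of sites. For $i < n$ a move from $i$ to $i+1$ changes
  only the sum that starts at site $i+1$. For $i \ge 1$ this sum is dominated by the one that starts
  at $i$, as site $i$ holds at least $d-1$ tokens; for $i = 0$ it is the total surplus, which the
  degree bound makes nonpositive and so dominated by the empty sum. Hence $y$ does not change. For
  $i = n$ every nonempty sum changes by one and the empty sum is dominated, so that $y$ changes by
  exactly $c_n = 1$ (\<open>potential_move\<close>). As $(d-1)(n-1) \le n(d-1)$, the theorem follows.
\<close>

section \<open>The binomials and their inconsistency\<close>

text \<open>
  The exponent vector of $x_i$, where $x_0$ and $x_{n+1}$ stand for $1$. With this convention the
  first and the last relation need no cases of their own. The variable $x_i$ has coordinate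
  \<open>i - 1\<close>.
\<close>

definition var_exp :: "nat \<Rightarrow> nat \<Rightarrow> exponent" where
  "var_exp n i = (\<lambda>j. if j < n \<and> Suc j = i then 1 else 0)"

definition lhs_exp :: "nat \<Rightarrow> nat \<Rightarrow> nat \<Rightarrow> exponent" where
  "lhs_exp n d i = (\<lambda>j. d * var_exp n i j)"

definition rhs_exp :: "nat \<Rightarrow> nat \<Rightarrow> nat \<Rightarrow> exponent" where
  "rhs_exp n d i = (\<lambda>j. (d - 1) * var_exp n i j + var_exp n (Suc i) j)"

definition rhs_coeff :: "nat \<Rightarrow> nat \<Rightarrow> real" where
  "rhs_coeff n i = (if i = n then 1 else 0)"

lemma lhs_in_exponents: "lhs_exp n d i \<in> exponents n"
  and rhs_in_exponents: "rhs_exp n d i \<in> exponents n"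
  by (auto simp: exponents_def lhs_exp_def rhs_exp_def var_exp_def)

lemma real_rhs_exp:
  "d \<ge> 1 \<Longrightarrow>
    real (rhs_exp n d i j) = (real d - 1) * real (var_exp n i j) + real (var_exp n (Suc i) j)"
  by (simp only: rhs_exp_def of_nat_add of_nat_mult of_nat_diff of_nat_1)

lemma exp_degree_var_exp_le: "exp_degree n (var_exp n i) \<le> 1"
proof -
  have "exp_degree n (var_exp n i) = (\<Sum>j<n. if j = i - 1 then (if i = 0 then 0 else 1) else 0)"
    unfolding exp_degree_def var_exp_def by (intro sum.cong) auto
  also have "\<dots> \<le> 1" by simp
  finally show ?thesis .
qed

lemma exp_degree_lhs_le: "exp_degree n (lhs_exp n d i) \<le> d"
  using mult_le_mono2[OF exp_degree_var_exp_le[of n i], of d]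
  by (simp add: exp_degree_def lhs_exp_def sum_distrib_left)

lemma exp_degree_rhs_le:
  assumes "d \<ge> 1"
  shows "exp_degree n (rhs_exp n d i) \<le> d"
proof -
  have "exp_degree n (rhs_exp n d i)
      = (d - 1) * exp_degree n (var_exp n i) + exp_degree n (var_exp n (Suc i))"
    by (simp add: exp_degree_def rhs_exp_def sum.distrib sum_distrib_left)
  also have "\<dots> \<le> (d - 1) * 1 + 1"
    by (intro add_mono mult_le_mono2 exp_degree_var_exp_le)
  finally show ?thesis using assms by simp
qed

lemma lhs_neq_rhs:
  assumes "n \<ge> 1" "d \<ge> 1" "i \<le> n"
  shows "lhs_exp n d i \<noteq> rhs_exp n d i"
proof (cases "i = n")
  case True
  then have "lhs_exp n d i (n - 1) \<noteq> rhs_exp n d i (n - 1)"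
    using assms by (auto simp: lhs_exp_def rhs_exp_def var_exp_def)
  then show ?thesis by auto
next
  case False
  then have "lhs_exp n d i i \<noteq> rhs_exp n d i i"
    using assms by (auto simp: lhs_exp_def rhs_exp_def var_exp_def)
  then show ?thesis by auto
qed

text \<open>
  The entry $d$ at the coordinate of $x_j$ cannot come from an earlier relation: in relation $i<j$
  the variable $x_j$ occurs at most to the first power. This makes the relations pairwise different.
\<close>

lemma lhs_exp_fresh:
  assumes "d \<ge> 2" "i < j" "j \<le> n"
  shows "lhs_exp n d j \<noteq> lhs_exp n d i" "lhs_exp n d j \<noteq> rhs_exp n d i"
proof -
  have "lhs_exp n d j (j - 1) \<noteq> lhs_exp n d i (j - 1)"
       "lhs_exp n d j (j - 1) \<noteq> rhs_exp n d i (j - 1)"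
    using assms by (auto simp: lhs_exp_def rhs_exp_def var_exp_def)
  then show "lhs_exp n d j \<noteq> lhs_exp n d i" "lhs_exp n d j \<noteq> rhs_exp n d i"
    by auto
qed

text \<open>
  Cancelling $d-1$ copies of the guard $x_i$ turns the relations into $a_i - a_{i+1} = c_i$,
  which telescopes to $0 = 1$ because both ends of the chain are the constant monomial.
\<close>

lemma no_common_root:
  fixes a :: "nat \<Rightarrow> real"
  assumes "d \<ge> 1"
    and eq: "\<And>i. i \<le> n \<Longrightarrow> (\<Sum>j<n. real (lhs_exp n d i j) * a j)
              = rhs_coeff n i + (\<Sum>j<n. real (rhs_exp n d i j) * a j)"
  shows False
proof -
  define t where "t i = (\<Sum>j<n. real (var_exp n i j) * a j)" for i
  have step: "t i - t (Suc i) = rhs_coeff n i" if "i \<le> n" for i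
  proof -
    have "(\<Sum>j<n. real (lhs_exp n d i j) * a j) = real d * t i"
      by (simp add: t_def lhs_exp_def sum_distrib_left mult_ac)
    moreover have "(\<Sum>j<n. real (rhs_exp n d i j) * a j) = (real d - 1) * t i + t (Suc i)"
      using \<open>d \<ge> 1\<close>
      by (simp add: t_def real_rhs_exp sum_distrib_left sum.distrib distrib_right mult.assoc)
    ultimately show ?thesis using eq[OF that] by (simp add: algebra_simps)
  qed
  have "(\<Sum>i\<le>n. t i - t (Suc i)) = t 0 - t (Suc n)"
    by (rule sum_telescope)
  also have "\<dots> = 0" by (simp add: t_def var_exp_def)
  finally have "(\<Sum>i\<le>n. rhs_coeff n i) = 0" by (simp add: step)
  then show False by (simp add: rhs_coeff_def)
qed

section \<open>The potential on monomials\<close>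

definition tail_excess :: "nat \<Rightarrow> nat \<Rightarrow> nat \<Rightarrow> exponent \<Rightarrow> real" where
  "tail_excess n d k I = (\<Sum>j=k..<n. real (I j) - (real d - 1))"

definition potential :: "nat \<Rightarrow> nat \<Rightarrow> exponent \<Rightarrow> real" where
  "potential n d I = (MAX k\<in>{..n}. tail_excess n d k I)"

text \<open>
  Removing the one index whose value differs between two configurations is how their maxima are
  compared; it is allowed when another index dominates it.
\<close>

lemma Max_image_remove:
  fixes f :: "'a \<Rightarrow> 'b::linorder"
  assumes "finite K" "j \<in> K" "j \<noteq> i" "f i \<le> f j"
  shows "Max (f ` K) = Max (f ` (K - {i}))"
proof (cases "i \<in> K")
  case True
  have "f i \<le> Max (f ` (K - {i}))"
    using assms by (intro order.trans[OF assms(4)] Max_ge) auto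
  moreover have "Max (insert (f i) (f ` (K - {i}))) = max (f i) (Max (f ` (K - {i})))"
    using assms by (intro Max_insert) auto
  moreover have "insert (f i) (f ` (K - {i})) = f ` K"
    using True by auto
  ultimately show ?thesis by (simp add: max_def)
qed simp

lemma tail_sum_var_exp:
  "(\<Sum>j=k..<n. real (var_exp n i j)) = (if k < i \<and> i \<le> n then 1 else 0)"
proof -
  have "(\<Sum>j=k..<n. real (var_exp n i j))
      = (\<Sum>j=k..<n. if j = i - 1 then (if i = 0 then 0 else 1) else 0)"
    by (intro sum.cong) (auto simp: var_exp_def)
  also have "\<dots> = (if k < i \<and> i \<le> n then 1 else 0)"
    by auto
  finally show ?thesis .
qed

text \<open>
  The two sides of relation \<open>i\<close> differ by one token on site \<open>i\<close> against one on site
  \<open>i + 1\<close>. The tail index \<open>k\<close> counts coordinates from \<open>0\<close>, so the tail contains site \<open>i\<close> iff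
  \<open>k < i\<close>. The equation is additive to cover the reservoir at both ends uniformly.
\<close>

lemma tail_excess_move:
  assumes "d \<ge> 1"
  shows "tail_excess n d k (\<lambda>j. J j + lhs_exp n d i j) + (if k < Suc i \<and> Suc i \<le> n then 1 else 0)
       = tail_excess n d k (\<lambda>j. J j + rhs_exp n d i j) + (if k < i \<and> i \<le> n then 1 else 0)"
  using assms unfolding tail_sum_var_exp[symmetric] tail_excess_def sum.distrib[symmetric]
  by (intro sum.cong) (auto simp: lhs_exp_def real_rhs_exp algebra_simps)

lemma tail_excess_Suc:
  "k < n \<Longrightarrow> tail_excess n d k I = real (I k) - (real d - 1) + tail_excess n d (Suc k) I"
  by (simp add: tail_excess_def sum.atLeast_Suc_lessThan)

lemma tail_excess_total:
  assumes "d \<ge> 1" "exp_degree n I \<le> n * (d - 1)"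
  shows "tail_excess n d 0 I \<le> 0"
proof -
  have "tail_excess n d 0 I = real (exp_degree n I) - real (n * (d - 1))"
    using assms(1)
    by (simp add: tail_excess_def exp_degree_def sum_subtractf of_nat_diff atLeast0LessThan)
  with assms(2) show ?thesis by linarith
qed

text \<open>
  For a move that does not return to the reservoir at the end of the chain, the only tail that
  changes can be dropped from the maximum. If the guard site exists, its \<open>d - 1\<close> tokens make the
  tail that includes it at least as large; if the token comes from the reservoir, the changing tail
  is the total surplus, which the degree bound puts below the empty tail.
\<close>

lemma potential_inner:
  assumes "d \<ge> 1" "i < n" "exp_degree n I \<le> n * (d - 1)" "i > 0 \<Longrightarrow> I (i - 1) \<ge> d - 1"
  shows "potential n d I = (MAX k\<in>{..n} - {i}. tail_excess n d k I)"
proof (cases i)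
  case 0
  have "tail_excess n d i I \<le> tail_excess n d n I"
    using tail_excess_total[OF assms(1,3)] 0 by (simp add: tail_excess_def)
  then show ?thesis
    unfolding potential_def using assms(2) by (intro Max_image_remove[of _ n]) auto
next
  case (Suc h)
  have "real d - 1 \<le> real (I h)" using assms(1,4) Suc by simp
  then have "tail_excess n d i I \<le> tail_excess n d h I"
    using tail_excess_Suc[of h n d I] Suc assms(2) by simp
  then show ?thesis
    unfolding potential_def using assms(2) Suc by (intro Max_image_remove[of _ h]) auto
qed

text \<open>
  For the last relation it is the empty tail, the only one unaffected by the move, that the
  \<open>d - 1\<close> tokens on the last site make redundant.
\<close>

lemma potential_last:
  assumes "d \<ge> 1" "n \<ge> 1" "I (n - 1) \<ge> d - 1"
  shows "potential n d I = (MAX k\<in>{..<n}. tail_excess n d k I)"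
proof -
  have "real d - 1 \<le> real (I (n - 1))" using assms(1,3) by linarith
  then have "tail_excess n d n I \<le> tail_excess n d (n - 1) I"
    using tail_excess_Suc[of "n - 1" n d I] assms(2) by simp
  then have "potential n d I = (MAX k\<in>{..n} - {n}. tail_excess n d k I)"
    unfolding potential_def using assms(2) by (intro Max_image_remove[of _ "n - 1"]) auto
  moreover have "{..n} - {n} = {..<n}" by auto
  ultimately show ?thesis by simp
qed

text \<open>
  The key step: the potential is an exact solution of the relations on all monomials of degree
  at most \<open>n * (d - 1)\<close>.
\<close>

lemma potential_move:
  fixes n d i :: nat and J :: exponent
  defines "U \<equiv> \<lambda>j. J j + lhs_exp n d i j" and "V \<equiv> \<lambda>j. J j + rhs_exp n d i j"
  assumes "d \<ge> 1" "n \<ge> 1" "i \<le> n"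
    and "exp_degree n U \<le> n * (d - 1)" "exp_degree n V \<le> n * (d - 1)"
  shows "potential n d U = rhs_coeff n i + potential n d V"
proof -
  \<comment> \<open>the tokens that stay on site \<open>i\<close> on both sides of the relation\<close>
  have guard: "d - 1 \<le> U (i - 1)" "d - 1 \<le> V (i - 1)" if "i > 0"
    using that assms(3,5) by (auto simp: U_def V_def lhs_exp_def rhs_exp_def var_exp_def)
  have move: "tail_excess n d k U + (if k < Suc i \<and> Suc i \<le> n then 1 else 0)
      = tail_excess n d k V + (if k < i \<and> i \<le> n then 1 else 0)" for k
    unfolding U_def V_def by (rule tail_excess_move[OF assms(3)])
  show ?thesis
  proof (cases "i < n")
    case True
    have "tail_excess n d k U = tail_excess n d k V" if "k \<noteq> i" for k
      using move[of k] that True by (auto split: if_splits)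
    then have "(MAX k\<in>{..n} - {i}. tail_excess n d k U)
        = (MAX k\<in>{..n} - {i}. tail_excess n d k V)"
      by (intro arg_cong[where f = Max] image_cong) auto
    then show ?thesis
      using potential_inner[OF assms(3) True] assms(6,7) guard True by (simp add: rhs_coeff_def)
  next
    case False
    then have i: "i = n" using assms(5) by simp
    have "tail_excess n d k U = tail_excess n d k V + 1" if "k < n" for k
      using move[of k] that i by simp
    then have "(MAX k\<in>{..<n}. tail_excess n d k U)
        = (MAX k\<in>{..<n}. tail_excess n d k V + 1)"
      by (intro arg_cong[where f = Max] image_cong) auto
    also have "\<dots> = (MAX k\<in>{..<n}. tail_excess n d k V) + 1"
      using assms(4) by (intro Max_add_commute) (auto simp: lessThan_empty_iff)
    finally show ?thesis
      using potential_last[OF assms(3,4)] guard i assms(4) by (simp add: rhs_coeff_def)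
  qed
qed

section \<open>Macaulay rows of monomials and binomials\<close>

definition mono_poly :: "real \<Rightarrow> exponent \<Rightarrow> trop_poly" where
  "mono_poly c A = (\<lambda>I. if I = A then ereal c else \<infinity>)"

definition binom_poly :: "exponent \<Rightarrow> real \<Rightarrow> exponent \<Rightarrow> trop_poly" where
  "binom_poly A c B = (\<lambda>I. if I = A then 0 else if I = B then ereal c else \<infinity>)"

lemma monomials_mono: "monomials (mono_poly c A) = {A}"
  by (auto simp: monomials_def mono_poly_def)

lemma monomials_binom: "monomials (binom_poly A c B) = {A, B}"
  by (auto simp: monomials_def binom_poly_def)

lemma is_trop_poly_mono: "A \<in> exponents n \<Longrightarrow> is_trop_poly n (mono_poly c A)"
  unfolding is_trop_poly_def monomials_mono by (auto simp: mono_poly_def)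

lemma is_trop_poly_binom:
  "A \<in> exponents n \<Longrightarrow> B \<in> exponents n \<Longrightarrow> is_trop_poly n (binom_poly A c B)"
  unfolding is_trop_poly_def monomials_binom by (auto simp: binom_poly_def)

lemma trop_value_mono:
  "trop_value n (mono_poly c A) a = ereal (c + (\<Sum>i<n. real (A i) * a i))"
  unfolding trop_value_def monomials_mono by (simp add: monomial_value_def mono_poly_def)

lemma trop_root_binomD:
  assumes "trop_root n (binom_poly A c B) a" "A \<noteq> B"
  shows "(\<Sum>i<n. real (A i) * a i) = c + (\<Sum>i<n. real (B i) * a i)"
proof -
  have "monomial_value n (binom_poly A c B) A a = monomial_value n (binom_poly A c B) B a"
    using assms(1) unfolding trop_root_def monomials_binom by auto
  then show ?thesis using assms(2) by (simp add: monomial_value_def binom_poly_def)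
qed

lemma finite_macaulay_cols: "finite (macaulay_cols n N)"
proof (rule finite_subset)
  show "macaulay_cols n N \<subseteq> {I. \<forall>i. (i \<in> {..<n} \<longrightarrow> I i \<in> {..N}) \<and> (i \<notin> {..<n} \<longrightarrow> I i = 0)}"
  proof
    fix I assume I: "I \<in> macaulay_cols n N"
    have "I i \<le> N" if "i < n" for i
      using member_le_sum[of i "{..<n}" I] that I
      by (auto simp: macaulay_cols_def exp_degree_def)
    then show "I \<in> {I. \<forall>i. (i \<in> {..<n} \<longrightarrow> I i \<in> {..N}) \<and> (i \<notin> {..<n} \<longrightarrow> I i = 0)}"
      using I by (auto simp: macaulay_cols_def exponents_def)
  qed
  show "finite {I. \<forall>i. (i \<in> {..<n} \<longrightarrow> I i \<in> {..N}) \<and> (i \<notin> {..<n} \<longrightarrow> I i = (0::nat))}"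
    by (rule finite_set_of_finite_funs) auto
qed

lemma shift_poly_add: "shift_poly J f (\<lambda>j. J j + A j) = f A"
  by (simp add: shift_poly_def)

lemma shift_poly_outside:
  assumes "\<And>A. A \<in> monomials f \<Longrightarrow> I \<noteq> (\<lambda>j. J j + A j)"
  shows "shift_poly J f I = \<infinity>"
proof (rule ccontr)
  assume fin: "shift_poly J f I \<noteq> \<infinity>"
  then have le: "\<forall>j. J j \<le> I j" by (auto simp: shift_poly_def split: if_splits)
  with fin have "(\<lambda>j. I j - J j) \<in> monomials f" by (simp add: shift_poly_def monomials_def)
  with assms[OF this] le show False by simp
qed

lemma macaulay_row_cols:
  assumes "(i, J) \<in> macaulay_rows n F N" "A \<in> monomials (F ! i)"
  shows "(\<lambda>j. J j + A j) \<in> macaulay_cols n N"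
  using assms by (auto simp: macaulay_rows_def macaulay_def shift_poly_add monomials_def)

lemma mono_row_Min:
  assumes "(i, J) \<in> macaulay_rows n F N" "F ! i = mono_poly c A"
  shows "(MIN I\<in>macaulay_cols n N. macaulay F (i, J) I + ereal (y I))
       = ereal (c + y (\<lambda>j. J j + A j))"
proof (rule Min_eqI)
  have "(\<lambda>j. J j + A j) \<in> macaulay_cols n N"
    using macaulay_row_cols[OF assms(1)] assms(2) by (simp add: monomials_mono)
  moreover have "macaulay F (i, J) (\<lambda>j. J j + A j) = ereal c"
    by (simp add: macaulay_def shift_poly_add assms(2) mono_poly_def)
  ultimately show "ereal (c + y (\<lambda>j. J j + A j))
      \<in> (\<lambda>I. macaulay F (i, J) I + ereal (y I)) ` macaulay_cols n N"
    by (intro rev_image_eqI[of "\<lambda>j. J j + A j"]) auto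
  fix v assume "v \<in> (\<lambda>I. macaulay F (i, J) I + ereal (y I)) ` macaulay_cols n N"
  then obtain I where v: "v = macaulay F (i, J) I + ereal (y I)" by auto
  show "ereal (c + y (\<lambda>j. J j + A j)) \<le> v"
  proof (cases "I = (\<lambda>j. J j + A j)")
    case True
    then show ?thesis
      by (simp add: v macaulay_def shift_poly_add assms(2) mono_poly_def)
  next
    case False
    then have "macaulay F (i, J) I = \<infinity>"
      by (auto simp: macaulay_def assms(2) monomials_mono intro!: shift_poly_outside)
    then show ?thesis by (simp add: v)
  qed
qed (simp add: finite_macaulay_cols)

text \<open>
  All entries of a row other than the two shifted terms are infinite, so equality of these two
  already makes both of them minimal.
\<close>

lemma binom_row_solved:
  fixes J A B :: exponent
  defines "U \<equiv> \<lambda>j. J j + A j" and "V \<equiv> \<lambda>j. J j + B j"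
  assumes row: "(i, J) \<in> macaulay_rows n F N" and F: "F ! i = binom_poly A c B" "A \<noteq> B"
    and y: "y U = c + y V"
  shows "\<exists>I\<in>macaulay_cols n N. \<exists>I'\<in>macaulay_cols n N. I \<noteq> I' \<and>
     macaulay F (i, J) I + ereal (y I) = (MIN I\<in>macaulay_cols n N. macaulay F (i, J) I + ereal (y I)) \<and>
     macaulay F (i, J) I' + ereal (y I') = (MIN I\<in>macaulay_cols n N. macaulay F (i, J) I + ereal (y I))"
proof -
  let ?h = "\<lambda>I. macaulay F (i, J) I + ereal (y I)"
  have cols: "U \<in> macaulay_cols n N" "V \<in> macaulay_cols n N"
    using macaulay_row_cols[OF row] F(1) by (auto simp: monomials_binom U_def V_def)
  have "U \<noteq> V"
    using F(2) by (auto simp: U_def V_def fun_eq_iff)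
  have hU: "?h U = ereal (y U)" and hV: "?h V = ereal (y U)"
    using F(2) unfolding y unfolding U_def V_def
    by (auto simp: macaulay_def shift_poly_add F(1) binom_poly_def y[unfolded U_def V_def])
  have "?h U \<le> ?h I" for I
  proof (cases "I = U \<or> I = V")
    case True
    then show ?thesis using hU hV by auto
  next
    case False
    then have "macaulay F (i, J) I = \<infinity>"
      by (auto simp: macaulay_def F(1) U_def V_def monomials_binom intro!: shift_poly_outside)
    then show ?thesis by simp
  qed
  then have "(MIN I\<in>macaulay_cols n N. ?h I) = ?h U"
    by (intro Min_eqI) (auto simp: finite_macaulay_cols cols)
  with cols \<open>U \<noteq> V\<close> hU hV show ?thesis by metis
qed

lemma potential_solves_row:
  assumes "d \<ge> 1" "n \<ge> 1" "i \<le> n" "N \<le> n * (d - 1)"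
    and "(\<lambda>j. J j + lhs_exp n d i j) \<in> macaulay_cols n N"
    and "(\<lambda>j. J j + rhs_exp n d i j) \<in> macaulay_cols n N"
  shows "potential n d (\<lambda>j. J j + lhs_exp n d i j)
       = rhs_coeff n i + potential n d (\<lambda>j. J j + rhs_exp n d i j)"
  using assms by (intro potential_move) (auto simp: macaulay_cols_def)

section \<open>The two systems\<close>

definition trop_system :: "nat \<Rightarrow> nat \<Rightarrow> trop_poly list" where
  "trop_system n d =
     map (\<lambda>i. binom_poly (lhs_exp n d i) (rhs_coeff n i) (rhs_exp n d i)) [0..<n + 1]"

definition minplus_system :: "nat \<Rightarrow> nat \<Rightarrow> minplus_poly list" where
  "minplus_system n d =
     map (\<lambda>i. (mono_poly 0 (lhs_exp n d i), mono_poly (rhs_coeff n i) (rhs_exp n d i)))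
       [0..<n + 1]"

lemma distinct_trop_system:
  assumes "d \<ge> 2"
  shows "distinct (trop_system n d)"
proof -
  have "inj_on (\<lambda>i. binom_poly (lhs_exp n d i) (rhs_coeff n i) (rhs_exp n d i)) {0..<n + 1}"
  proof (rule linorder_inj_onI)
    fix i j assume ij: "i < j" "i \<in> {0..<n + 1}" "j \<in> {0..<n + 1}"
    have "lhs_exp n d j \<notin> {lhs_exp n d i, rhs_exp n d i}"
      using lhs_exp_fresh[OF assms ij(1)] ij(3) by auto
    then show "binom_poly (lhs_exp n d i) (rhs_coeff n i) (rhs_exp n d i)
        \<noteq> binom_poly (lhs_exp n d j) (rhs_coeff n j) (rhs_exp n d j)"
      by (metis insertI1 monomials_binom)
  qed auto
  then show ?thesis unfolding trop_system_def distinct_map set_upt by (intro conjI distinct_upt)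
qed

lemma distinct_minplus_system:
  assumes "d \<ge> 2"
  shows "distinct (minplus_system n d)"
proof -
  have "inj_on (\<lambda>i. (mono_poly 0 (lhs_exp n d i), mono_poly (rhs_coeff n i) (rhs_exp n d i)))
      {0..<n + 1}"
  proof (rule linorder_inj_onI)
    fix i j assume ij: "i < j" "i \<in> {0..<n + 1}" "j \<in> {0..<n + 1}"
    have "lhs_exp n d j \<noteq> lhs_exp n d i"
      using lhs_exp_fresh(1)[OF assms ij(1)] ij(3) by auto
    then have "mono_poly 0 (lhs_exp n d i) \<noteq> mono_poly 0 (lhs_exp n d j)"
      by (metis monomials_mono singleton_inject)
    then show "(mono_poly 0 (lhs_exp n d i), mono_poly (rhs_coeff n i) (rhs_exp n d i))
        \<noteq> (mono_poly 0 (lhs_exp n d j), mono_poly (rhs_coeff n j) (rhs_exp n d j))" by simp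
  qed auto
  then show ?thesis unfolding minplus_system_def distinct_map set_upt by (intro conjI distinct_upt)
qed

lemma trop_system_solution:
  assumes "d \<ge> 1" "n \<ge> 1" "N \<le> n * (d - 1)"
  shows "macaulay_trop_solution n (trop_system n d) N (potential n d)"
  unfolding macaulay_trop_solution_def trop_linear_solution_def Let_def
proof (intro ballI disjI2)
  fix r assume r: "r \<in> macaulay_rows n (trop_system n d) N"
  obtain i J where rij: "r = (i, J)" by (cases r)
  with r have i: "i \<le> n" by (simp add: macaulay_rows_def trop_system_def)
  have F: "trop_system n d ! i = binom_poly (lhs_exp n d i) (rhs_coeff n i) (rhs_exp n d i)"
    using i unfolding trop_system_def by (simp del: upt_Suc)
  show "\<exists>I\<in>macaulay_cols n N. \<exists>I'\<in>macaulay_cols n N. I \<noteq> I' \<and>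
     macaulay (trop_system n d) r I + ereal (potential n d I)
       = (MIN I\<in>macaulay_cols n N. macaulay (trop_system n d) r I + ereal (potential n d I)) \<and>
     macaulay (trop_system n d) r I' + ereal (potential n d I')
       = (MIN I\<in>macaulay_cols n N. macaulay (trop_system n d) r I + ereal (potential n d I))"
    unfolding rij
  proof (rule binom_row_solved[OF _ F])
    show row: "(i, J) \<in> macaulay_rows n (trop_system n d) N" using r rij by simp
    show "lhs_exp n d i \<noteq> rhs_exp n d i" using lhs_neq_rhs assms i by auto
    show "potential n d (\<lambda>j. J j + lhs_exp n d i j)
        = rhs_coeff n i + potential n d (\<lambda>j. J j + rhs_exp n d i j)"
      using assms i macaulay_row_cols[OF row, unfolded F monomials_binom]
      by (intro potential_solves_row) auto
  qed
qed

lemma minplus_system_solution: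
  assumes "d \<ge> 1" "n \<ge> 1" "N \<le> n * (d - 1)"
  shows "macaulay_minplus_solution n (minplus_system n d) N (potential n d)"
  unfolding macaulay_minplus_solution_def minplus_linear_solution_def
proof
  let ?L = "map fst (minplus_system n d)" and ?R = "map snd (minplus_system n d)"
  fix r assume r: "r \<in> macaulay_rows n ?L N \<inter> macaulay_rows n ?R N"
  obtain i J where rij: "r = (i, J)" by (cases r)
  with r have i: "i \<le> n" by (simp add: macaulay_rows_def minplus_system_def)
  have rows: "(i, J) \<in> macaulay_rows n ?L N" "(i, J) \<in> macaulay_rows n ?R N"
    using r rij by auto
  have L: "?L ! i = mono_poly 0 (lhs_exp n d i)"
    and R: "?R ! i = mono_poly (rhs_coeff n i) (rhs_exp n d i)"
    using i unfolding minplus_system_def by (simp_all del: upt_Suc)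
  have "potential n d (\<lambda>j. J j + lhs_exp n d i j)
      = rhs_coeff n i + potential n d (\<lambda>j. J j + rhs_exp n d i j)"
    using assms i macaulay_row_cols[OF rows(1), unfolded L monomials_mono]
      macaulay_row_cols[OF rows(2), unfolded R monomials_mono]
    by (intro potential_solves_row) auto
  then show "(MIN I\<in>macaulay_cols n N. macaulay ?L r I + ereal (potential n d I))
      = (MIN I\<in>macaulay_cols n N. macaulay ?R r I + ereal (potential n d I))"
    unfolding rij mono_row_Min[OF rows(1) L] mono_row_Min[OF rows(2) R] by simp
qed

theorem mainTheorem14:
  fixes n d :: nat
  assumes "n \<ge> 1" and "d \<ge> 2"
  shows
    "(\<exists>F :: trop_poly list.
        length F = n + 1 \<and> distinct F \<and>
        (\<forall>f\<in>set F. is_trop_poly n f \<and> trop_degree n f \<le> d) \<and>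
        \<not> (\<exists>a :: nat \<Rightarrow> real. \<forall>f\<in>set F. trop_root n f a) \<and>
        (\<exists>y :: exponent \<Rightarrow> real. macaulay_trop_solution n F ((d - 1) * (n - 1)) y)) \<and>
     (\<exists>F :: minplus_poly list.
        length F = n + 1 \<and> distinct F \<and>
        (\<forall>p\<in>set F. is_minplus_poly n p \<and> minplus_degree n p \<le> d) \<and>
        \<not> (\<exists>a :: nat \<Rightarrow> real. \<forall>p\<in>set F. minplus_root n p a) \<and>
        (\<exists>y :: exponent \<Rightarrow> real. macaulay_minplus_solution n F ((d - 1) * (n - 1)) y))"
proof
  have d: "d \<ge> 1" using assms by simp
  have N: "(d - 1) * (n - 1) \<le> n * (d - 1)" by simp
  note deg = exp_degree_lhs_le exp_degree_rhs_le[OF d]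
  have "False" if "\<forall>f\<in>set (trop_system n d). trop_root n f a" for a
  proof (rule no_common_root[OF d])
    fix i assume "i \<le> n"
    then have "trop_root n (binom_poly (lhs_exp n d i) (rhs_coeff n i) (rhs_exp n d i)) a"
      using that unfolding trop_system_def by (auto simp del: upt_Suc)
    then show "(\<Sum>j<n. real (lhs_exp n d i j) * a j)
        = rhs_coeff n i + (\<Sum>j<n. real (rhs_exp n d i j) * a j)"
      using \<open>i \<le> n\<close> d assms(1) by (intro trop_root_binomD lhs_neq_rhs)
  qed
  moreover have "is_trop_poly n f \<and> trop_degree n f \<le> d" if "f \<in> set (trop_system n d)" for f
    using that deg unfolding trop_system_def
    by (auto simp: trop_degree_def monomials_binom is_trop_poly_binom lhs_in_exponents
        rhs_in_exponents simp del: upt_Suc)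
  moreover have "length (trop_system n d) = n + 1" by (simp add: trop_system_def)
  ultimately show "\<exists>F :: trop_poly list.
        length F = n + 1 \<and> distinct F \<and>
        (\<forall>f\<in>set F. is_trop_poly n f \<and> trop_degree n f \<le> d) \<and>
        \<not> (\<exists>a :: nat \<Rightarrow> real. \<forall>f\<in>set F. trop_root n f a) \<and>
        (\<exists>y :: exponent \<Rightarrow> real. macaulay_trop_solution n F ((d - 1) * (n - 1)) y)"
    using distinct_trop_system[OF assms(2)] trop_system_solution[OF d assms(1) N] by blast
  have "False" if "\<forall>p\<in>set (minplus_system n d). minplus_root n p a" for a
  proof (rule no_common_root[OF d])
    fix i assume "i \<le> n"
    then have "minplus_root n
        (mono_poly 0 (lhs_exp n d i), mono_poly (rhs_coeff n i) (rhs_exp n d i)) a"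
      using that unfolding minplus_system_def by (auto simp del: upt_Suc)
    then show "(\<Sum>j<n. real (lhs_exp n d i j) * a j)
        = rhs_coeff n i + (\<Sum>j<n. real (rhs_exp n d i j) * a j)"
      by (simp add: minplus_root_def trop_value_mono)
  qed
  moreover have "is_minplus_poly n p \<and> minplus_degree n p \<le> d"
    if "p \<in> set (minplus_system n d)" for p
    using that deg unfolding minplus_system_def
    by (auto simp: is_minplus_poly_def minplus_degree_def trop_degree_def monomials_mono
        is_trop_poly_mono lhs_in_exponents rhs_in_exponents simp del: upt_Suc)
  moreover have "length (minplus_system n d) = n + 1" by (simp add: minplus_system_def)
  ultimately show "\<exists>F :: minplus_poly list.
        length F = n + 1 \<and> distinct F \<and>
        (\<forall>p\<in>set F. is_minplus_poly n p \<and> minplus_degree n p \<le> d) \<and>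
        \<not> (\<exists>a :: nat \<Rightarrow> real. \<forall>p\<in>set F. minplus_root n p a) \<and>
        (\<exists>y :: exponent \<Rightarrow> real. macaulay_minplus_solution n F ((d - 1) * (n - 1)) y)"
    using distinct_minplus_system[OF assms(2)] minplus_system_solution[OF d assms(1) N] by blast
qed

end
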